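(* The bivariate quartic polynomial $$p(x_1,x_2) = x_1^4 - x_1^2 + 2x_1 + x_2^4 - x_2^2 - 2x_2 + \frac{12}{5} - 2x_1x_2$$ is separable plus quadratic (SPQ) and is a sum of squares, but it cannot be written as the sum of a nonnegative separable polynomial and a nonnegative quadratic polynomial.
   Context: All polynomials have real coefficients. A polynomial $p:\mathbb{R}^n\to\mathbb{R}$ is separable if $p(x)=\sum_{i=1}^n s_i(x_i)$ for some univariate polynomials $s_i$. It is separable plus quadratic (SPQ) if it is the sum of a separable polynomial and a quadratic polynomial, where a quadratic polynomial is a polynomial of degree at most $2$ (not necessarily homogeneous). It is nonnegative if $p(x)\ge 0$ for all $x\in\mathbb{R}^n$. It is a sum of squares (sos) if $p=\sum_{i=1}^m q_i^2$ for some polynomials $q_1,\dots,q_m$. *)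

theory Defs
  imports "HOL-Analysis.Analysis"
begin

text \<open>
  Real polynomials in \<open>n\<close> variables are identified with the functions they induce on
  \<open>\<real>\<^sup>n\<close>, which determine them because \<open>\<real>\<close> is infinite; "polynomial" without a degree
  bound is \<^const>\<open>real_polynomial_function\<close>.
\<close>

text \<open>The exponent vector \<open>\<alpha>\<close> ranges over all monomials of total degree at most \<open>d\<close>.\<close>

definition poly_fun_degree_le :: "nat \<Rightarrow> (real ^ 'n \<Rightarrow> real) \<Rightarrow> bool" where
  "poly_fun_degree_le d p \<longleftrightarrow>
     (\<exists>c :: ('n \<Rightarrow> nat) \<Rightarrow> real. \<forall>x.
        p x = (\<Sum>\<alpha> | (\<Sum>i\<in>UNIV. \<alpha> i) \<le> d. c \<alpha> * (\<Prod>i\<in>UNIV. (x $ i) ^ \<alpha> i)))"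

lemma finite_exponents_degree_le: "finite {\<alpha> :: 'n::finite \<Rightarrow> nat. (\<Sum>i\<in>UNIV. \<alpha> i) \<le> d}"
proof (rule finite_subset)
  show "{\<alpha> :: 'n \<Rightarrow> nat. (\<Sum>i\<in>UNIV. \<alpha> i) \<le> d} \<subseteq> Pi\<^sub>E UNIV (\<lambda>_. {..d})"
  proof
    fix \<alpha> :: "'n \<Rightarrow> nat" assume a: "\<alpha> \<in> {\<alpha>. (\<Sum>i\<in>UNIV. \<alpha> i) \<le> d}"
    have "\<alpha> i \<le> d" for i
    proof -
      have "\<alpha> i \<le> sum \<alpha> UNIV" by (rule member_le_sum) simp_all
      with a show ?thesis by simp
    qed
    then show "\<alpha> \<in> Pi\<^sub>E UNIV (\<lambda>_. {..d})" by (simp add: PiE_def Pi_def)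
  qed
  show "finite (Pi\<^sub>E (UNIV :: 'n set) (\<lambda>_. {..d}))"
    by (rule finite_PiE) simp_all
qed

lemma real_polynomial_function_if_degree_le:
  fixes p :: "real ^ 'n \<Rightarrow> real"
  assumes "poly_fun_degree_le d p"
  shows "real_polynomial_function p"
proof -
  obtain c where "p = (\<lambda>x. \<Sum>\<alpha> | (\<Sum>i\<in>UNIV. \<alpha> i) \<le> d. c \<alpha> * (\<Prod>i\<in>UNIV. (x $ i) ^ \<alpha> i))"
    using assms unfolding poly_fun_degree_le_def by blast
  moreover have "real_polynomial_function (\<lambda>x :: real ^ 'n. (x $ i) ^ k)" for i k
    by (rule real_polynomial_function_power, rule real_polynomial_function.intros(1),
        rule bounded_linear_vec_nth)
  then have "real_polynomial_function (\<lambda>x :: real ^ 'n. a * (\<Prod>i\<in>UNIV. (x $ i) ^ \<alpha> i))" for a \<alpha>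
    by (rule real_polynomial_function.intros(4)[OF real_polynomial_function.intros(2)
          real_polynomial_function_prod[OF finite]])
  ultimately show ?thesis
    by (simp add: real_polynomial_function_sum finite_exponents_degree_le)
qed

definition quadratic_polynomial :: "(real ^ 'n \<Rightarrow> real) \<Rightarrow> bool" where
  "quadratic_polynomial p \<longleftrightarrow> poly_fun_degree_le 2 p"

definition separable_polynomial :: "(real ^ 'n \<Rightarrow> real) \<Rightarrow> bool" where
  "separable_polynomial p \<longleftrightarrow>
     (\<exists>s :: 'n \<Rightarrow> real poly. \<forall>x. p x = (\<Sum>i\<in>UNIV. poly (s i) (x $ i)))"

definition spq_polynomial :: "(real ^ 'n \<Rightarrow> real) \<Rightarrow> bool" where
  "spq_polynomial p \<longleftrightarrow>
     (\<exists>s q. separable_polynomial s \<and> quadratic_polynomial q \<and> (\<forall>x. p x = s x + q x))"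

definition nonnegative_polynomial :: "(real ^ 'n \<Rightarrow> real) \<Rightarrow> bool" where
  "nonnegative_polynomial p \<longleftrightarrow> (\<forall>x. 0 \<le> p x)"

definition sos_polynomial :: "(real ^ 'n \<Rightarrow> real) \<Rightarrow> bool" where
  "sos_polynomial p \<longleftrightarrow>
     (\<exists>(m::nat) q. (\<forall>i\<in>{1..m}. real_polynomial_function (q i)) \<and>
        (\<forall>x. p x = (\<Sum>i=1..m. (q i x)\<^sup>2)))"

end

theory Submission
  imports Defs
begin

text \<open>
  With \<open>u = x\<^sub>1 - x\<^sub>2\<close> and \<open>v = x\<^sub>1 + x\<^sub>2\<close> one has
  \<open>p = (u\<^sup>4 + 6u\<^sup>2v\<^sup>2 + v\<^sup>4)/8 - v\<^sup>2 + 2u + 12/5\<close>, which is quadratic in \<open>v\<^sup>2\<close>. Hence one looks for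
  \<open>p = (v\<^sup>2 + c(u))\<^sup>2/8 + v\<^sup>2 g(u) + h(u)\<close> with \<open>c\<close> quadratic and \<open>g, h\<close> nonnegative, and \<open>g\<close>, \<open>h\<close>
  are sums of squares because they are univariate.

  For the impossibility, a decomposition \<open>p = s + q\<close> forces the coefficient of \<open>x\<^sub>1x\<^sub>2\<close> in
  \<open>q\<close> to be \<open>-2\<close>. Put weights \<open>3, 1\<close> on \<open>(-1,1), (1,-1)\<close> and also on \<open>(-1,0), (1,2)\<close>.
  These two measures have the same moments \<open>1, x\<^sub>1, x\<^sub>1\<^sup>2, x\<^sub>2, x\<^sub>2\<^sup>2\<close>, so integrating \<open>s\<close> against the
  first and \<open>q\<close> against the second gives a value that depends on \<open>p\<close> alone, namely
  \<open>-12/5\<close>. It would be nonnegative if \<open>s\<close> and \<open>q\<close> were.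
\<close>

text \<open>Exponent vectors on the two-element index type are pairs \<open>(i, j)\<close>, with
  \<open>i\<close> the exponent of \<open>x $ 1\<close>, so the sum becomes iterated and
  \<open>simp\<close> can expand it.\<close>

lemma sum_exponents_2:
  fixes g :: "(2 \<Rightarrow> nat) \<Rightarrow> real"
  shows "(\<Sum>\<alpha> | (\<Sum>i\<in>UNIV. \<alpha> i) \<le> d. g \<alpha>) =
         (\<Sum>i\<le>d. \<Sum>j\<le>d - i. g (\<lambda>k. if k = 1 then i else j))"
proof -
  let ?e = "\<lambda>(i, j) (k::2). if k = 1 then i else (j::nat)"
  have "bij_betw ?e (SIGMA i:{..d}. {..d - i}) {\<alpha>. (\<Sum>i\<in>UNIV. \<alpha> i) \<le> d}"
    by (rule bij_betw_byWitness[where f' = "\<lambda>\<alpha>. (\<alpha> 1, \<alpha> 2)"])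
       (auto simp: sum_2 fun_eq_iff forall_2)
  from sum.reindex_bij_betw[OF this, of g, symmetric] show ?thesis
    by (simp add: sum.Sigma split_def)
qed

lemma quadratic_polynomial_2E:
  fixes q :: "real ^ 2 \<Rightarrow> real"
  assumes "quadratic_polynomial q"
  obtains a b c d e f where
    "\<And>x. q x = a + b * x $ 1 + c * x $ 2 + d * (x $ 1)\<^sup>2 + e * (x $ 1 * x $ 2) + f * (x $ 2)\<^sup>2"
proof -
  let ?m = "\<lambda>i j (k::2). if k = 1 then i else (j::nat)"
  obtain c where c: "\<And>x. q x =
      (\<Sum>\<alpha> | (\<Sum>i\<in>UNIV. \<alpha> i) \<le> 2. c \<alpha> * (\<Prod>i\<in>UNIV. (x $ i) ^ \<alpha> i))"
    using assms unfolding quadratic_polynomial_def poly_fun_degree_le_def by blast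
  show thesis
    by (rule that[of "c (?m 0 0)" "c (?m (Suc 0) 0)" "c (?m 0 (Suc 0))"
          "c (?m (Suc (Suc 0)) 0)" "c (?m (Suc 0) (Suc 0))" "c (?m 0 (Suc (Suc 0)))"])
       (unfold c sum_exponents_2, simp add: UNIV_2 numeral_2_eq_2 cong: sum.cong)
qed

lemma quadratic_polynomial_mult_2:
  "quadratic_polynomial (\<lambda>x :: real ^ 2. a * (x $ 1 * x $ 2))"
  unfolding quadratic_polynomial_def poly_fun_degree_le_def
  by (rule exI[of _ "\<lambda>\<alpha>. if \<alpha> = (\<lambda>_. 1) then a else 0"], unfold sum_exponents_2)
     (simp add: UNIV_2 numeral_2_eq_2 fun_eq_iff forall_2)

lemma separable_polynomial_2_exchange:
  fixes s :: "real ^ 2 \<Rightarrow> real"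
  assumes "separable_polynomial s"
  shows "s (vector [a, b]) + s (vector [c, d]) = s (vector [a, d]) + s (vector [c, b])"
  using assms unfolding separable_polynomial_def by (auto simp: sum_2)

lemma sos_polynomial_zero: "sos_polynomial (\<lambda>_. 0)"
  unfolding sos_polynomial_def by (intro exI[of _ 0]) simp

lemma sos_polynomial_add_square:
  assumes "sos_polynomial p" "real_polynomial_function r" "0 \<le> c"
  shows "sos_polynomial (\<lambda>x. p x + c * (r x)\<^sup>2)"
proof -
  obtain m :: nat and q where q: "\<And>i. i \<in> {1..m} \<Longrightarrow> real_polynomial_function (q i)"
    and p: "\<And>x. p x = (\<Sum>i=1..m. (q i x)\<^sup>2)"
    using assms(1) unfolding sos_polynomial_def by blast
  let ?q = "q(Suc m := \<lambda>x. sqrt c * r x)"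
  have "real_polynomial_function (?q i)" if "i \<in> {1..Suc m}" for i
    using that q assms(2) by (auto intro: real_polynomial_function.intros)
  moreover have "p x + c * (r x)\<^sup>2 = (\<Sum>i=1..Suc m. (?q i x)\<^sup>2)" for x
    using assms(3) by (simp add: p power_mult_distrib)
  ultimately show ?thesis
    unfolding sos_polynomial_def by blast
qed

theorem lemma2p6:
  fixes p :: "real ^ 2 \<Rightarrow> real"
  assumes "\<And>x. p x = (x $ 1) ^ 4 - (x $ 1) ^ 2 + 2 * (x $ 1) + (x $ 2) ^ 4 - (x $ 2) ^ 2
                     - 2 * (x $ 2) + 12 / 5 - 2 * (x $ 1) * (x $ 2)"
  shows "spq_polynomial p \<and> sos_polynomial p \<and>
         \<not> (\<exists>s q. separable_polynomial s \<and> nonnegative_polynomial s \<and>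
                  quadratic_polynomial q \<and> nonnegative_polynomial q \<and>
                  (\<forall>x. p x = s x + q x))"
proof (intro conjI notI)
  let ?s = "\<lambda>i::2. if i = 1 then [:12/5, 2, -1, 0, 1:] else [:0, -2, -1, 0, 1 :: real:]"
  have "p x = (\<Sum>i\<in>UNIV. poly (?s i) (x $ i)) + (- 2) * (x $ 1 * x $ 2)" for x
    by (simp add: assms sum_2 algebra_simps power2_eq_square power4_eq_xxxx)
  moreover have "separable_polynomial (\<lambda>x. \<Sum>i\<in>UNIV. poly (?s i) (x $ i))"
    unfolding separable_polynomial_def by (intro exI[of _ ?s]) simp
  ultimately show "spq_polynomial p"
    unfolding spq_polynomial_def using quadratic_polynomial_mult_2[of "- 2"] by blast
next
  define u v :: "real ^ 2 \<Rightarrow> real" where "u x = x $ 1 - x $ 2" and "v x = x $ 1 + x $ 2" for x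
  have coord: "real_polynomial_function (\<lambda>x :: real ^ 2. x $ i)" for i
    by (rule real_polynomial_function.intros(1), rule bounded_linear_vec_nth)
  have uv: "real_polynomial_function u" "real_polynomial_function v"
    unfolding u_def v_def
    by (auto intro: real_polynomial_function_diff real_polynomial_function.intros(3) coord)
  note poly_intros = uv real_polynomial_function_diff real_polynomial_function_power
    real_polynomial_function.intros(2-4)
  \<comment> \<open>Here c(u) = (2u^2 - 5u - 13)/3, g = (7u^2 + 5u + 1)/12 fills the second and
    third squares, and h the rest.\<close>
  have "sos_polynomial (\<lambda>x. 0
      + 1/72 * (3 * (v x)\<^sup>2 + 2 * (u x)\<^sup>2 - 5 * u x - 13)\<^sup>2
      + 1/48 * (v x * (5 * u x + 2))\<^sup>2
      + 1/16 * (v x * u x)\<^sup>2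
      + 1/360 * (5 * (u x)\<^sup>2 + 10 * u x + 3)\<^sup>2
      + 1/72 * (u x + 1)\<^sup>2
      + 1/72 * 1\<^sup>2)"
    by (intro sos_polynomial_add_square sos_polynomial_zero poly_intros) simp_all
  also have "(\<lambda>x. 0
      + 1/72 * (3 * (v x)\<^sup>2 + 2 * (u x)\<^sup>2 - 5 * u x - 13)\<^sup>2
      + 1/48 * (v x * (5 * u x + 2))\<^sup>2
      + 1/16 * (v x * u x)\<^sup>2
      + 1/360 * (5 * (u x)\<^sup>2 + 10 * u x + 3)\<^sup>2
      + 1/72 * (u x + 1)\<^sup>2
      + 1/72 * 1\<^sup>2) = p"
    unfolding fun_eq_iff assms u_def v_def by (intro allI, simp add: field_simps) algebra
  finally show "sos_polynomial p" .
next
  assume "\<exists>s q. separable_polynomial s \<and> nonnegative_polynomial s \<and>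
                quadratic_polynomial q \<and> nonnegative_polynomial q \<and> (\<forall>x. p x = s x + q x)"
  then obtain s q where sep: "separable_polynomial s" and s: "\<And>x. 0 \<le> s x"
    and quad: "quadratic_polynomial q" and q: "\<And>x. 0 \<le> q x" and sum: "\<And>x. p x = s x + q x"
    unfolding nonnegative_polynomial_def by blast
  obtain a b c d e f where q_eq: "\<And>x. q x =
      a + b * x $ 1 + c * x $ 2 + d * (x $ 1)\<^sup>2 + e * (x $ 1 * x $ 2) + f * (x $ 2)\<^sup>2"
    using quadratic_polynomial_2E[OF quad] by metis
  have s_eq: "s x = p x - q x" for x
    using sum[of x] by simp
  \<comment> \<open>The mixed difference over the unit square vanishes on \<open>s\<close>, is -2 on
    \<open>p\<close> and \<open>e\<close> on \<open>q\<close>.\<close>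
  have "e = - 2"
    using separable_polynomial_2_exchange[OF sep, of 1 1 0 0] by (simp add: s_eq assms q_eq)
  \<comment> \<open>By the equal moments all coefficients of \<open>q\<close> but \<open>e\<close>
    cancel, leaving 48/5 + 6\<open>e\<close>.\<close>
  then have "3 * s (vector [-1, 1]) + s (vector [1, -1])
      + 3 * q (vector [-1, 0]) + q (vector [1, 2]) = - 12 / 5"
    by (simp add: s_eq assms q_eq)
  then show False
    using s[of "vector [-1, 1]"] s[of "vector [1, -1]"]
      q[of "vector [-1, 0]"] q[of "vector [1, 2]"] by linarith
qed

end
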